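(* Let $(\{V_k\}_{k\in\mathbb{N}},\{\phi_k\}_{k\in\mathbb{N}})$ be an inductive system in the category $\mathbf{AOU}$ of Archimedean order unit spaces and unital positive linear maps, and let $\varinjlim_{\mathbf{AOU}}V_k$ be its inductive limit in $\mathbf{AOU}$. Then the state space $S(\varinjlim_{\mathbf{AOU}}V_k)$ is homeomorphic to $\varprojlim_{\mathbf{Top}}S(V_k)$, the inverse limit of the system $S(V_1)\xleftarrow{\phi_1'}S(V_2)\xleftarrow{\phi_2'}S(V_3)\xleftarrow{\phi_3'}\cdots$ with $\phi_k'(f)=f\circ\phi_k$.
   Context: An ordered $*$-vector space is a complex vector space $V$ with a conjugate-linear involution and a cone $V^+\subseteq V_h=\{x:x^*=x\}$ with $V^+\cap(-V^+)=\{0\}$. An Archimedean order unit is $e\in V^+$ such that for every $x\in V_h$ there is $r>0$ with $re-x\in V^+$, and such that $V^+=\{x\in V_h:re+x\in V^+\ \forall r>0\}$. An Archimedean order unit (AOU) space is an ordered $*$-vector space with an Archimedean order unit. $\mathbf{AOU}$ has AOU spaces as objects and unital (order-unit-preserving) positive (cone-preserving) linear maps as morphisms. A state on $V$ is a unital positive linear functional $V\to\mathbb{C}$; $S(V)$ is the set of states with the weak* topology (pointwise convergence on $V$). The inductive limit in $\mathbf{AOU}$ is an object with morphisms $\phi_{k,\infty}$ from $V_k$ satisfying $\phi_{k+1,\infty}\circ\phi_k=\phi_{k,\infty}$ and universal with this property; it exists and is unique up to unital order isomorphism. The inverse limit in $\mathbf{Top}$ of $X_1\xleftarrow{f_1}X_2\xleftarrow{f_2}\cdots$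 is $\{(x_k)_k\in\prod_kX_k:f_k(x_{k+1})=x_k\ \forall k\}$ with the topology inherited from the product topology. *)

theory Defs
  imports "HOL-Analysis.Analysis" "HOL-Algebra.Algebraic_Closure_Type"
begin

text \<open>Complex vector spaces are modules over the field of complex numbers in the sense of
  HOL-Algebra; the ring multiplication and unit fields inherited by the record \<open>module\<close>
  play no role.\<close>

record 'v aou = "(complex, 'v) module" +
  star :: "'v \<Rightarrow> 'v"
  cone :: "'v set"
  order_unit :: 'v

definition hermitian :: "('v, 'm) aou_scheme \<Rightarrow> 'v set" where
  "hermitian V = {x \<in> carrier V. star V x = x}"

locale ordered_star_vector_space =
  module "ring_of_type_algebra :: complex ring" V for V :: "('v, 'm) aou_scheme" (structure) +
  assumes star_closed: "x \<in> carrier V \<Longrightarrow> star V x \<in> carrier V"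
    and star_star: "x \<in> carrier V \<Longrightarrow> star V (star V x) = x"
    and star_add: "\<lbrakk>x \<in> carrier V; y \<in> carrier V\<rbrakk> \<Longrightarrow> star V (x \<oplus>\<^bsub>V\<^esub> y) = star V x \<oplus>\<^bsub>V\<^esub> star V y"
    and star_smult: "x \<in> carrier V \<Longrightarrow> star V (c \<odot>\<^bsub>V\<^esub> x) = cnj c \<odot>\<^bsub>V\<^esub> star V x"
    and cone_hermitian: "cone V \<subseteq> hermitian V"
    and cone_add: "\<lbrakk>x \<in> cone V; y \<in> cone V\<rbrakk> \<Longrightarrow> x \<oplus>\<^bsub>V\<^esub> y \<in> cone V"
    and cone_smult: "\<lbrakk>0 \<le> r; x \<in> cone V\<rbrakk> \<Longrightarrow> complex_of_real r \<odot>\<^bsub>V\<^esub> x \<in> cone V"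
    and cone_proper: "cone V \<inter> (\<lambda>x. \<ominus>\<^bsub>V\<^esub> x) ` cone V = {\<zero>\<^bsub>V\<^esub>}"

locale aou_space = ordered_star_vector_space V for V :: "('v, 'm) aou_scheme" (structure) +
  assumes order_unit_cone: "order_unit V \<in> cone V"
    and order_unit_dominates:
      "x \<in> hermitian V \<Longrightarrow> \<exists>r>0. complex_of_real r \<odot>\<^bsub>V\<^esub> order_unit V \<ominus>\<^bsub>V\<^esub> x \<in> cone V"
    and archimedean:
      "cone V = {x \<in> hermitian V. \<forall>r>0. complex_of_real r \<odot>\<^bsub>V\<^esub> order_unit V \<oplus>\<^bsub>V\<^esub> x \<in> cone V}"

text \<open>Morphisms are extensional functions (\<open>undefined\<close> outside the carrier of the
  domain), so that equality of morphisms is HOL equality; they are composed with \<open>compose\<close>.\<close>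

definition aou_hom :: "('v, 'm) aou_scheme \<Rightarrow> ('w, 'n) aou_scheme \<Rightarrow> ('v \<Rightarrow> 'w) set" where
  "aou_hom V W = {f \<in> carrier V \<rightarrow>\<^sub>E carrier W.
     (\<forall>x\<in>carrier V. \<forall>y\<in>carrier V. f (x \<oplus>\<^bsub>V\<^esub> y) = f x \<oplus>\<^bsub>W\<^esub> f y) \<and>
     (\<forall>c. \<forall>x\<in>carrier V. f (c \<odot>\<^bsub>V\<^esub> x) = c \<odot>\<^bsub>W\<^esub> f x) \<and>
     f ` cone V \<subseteq> cone W \<and>
     f (order_unit V) = order_unit W}"

definition complex_aou :: "complex aou" where
  "complex_aou = ring.extend ring_of_type_algebra
     \<lparr>smult = (*), star = cnj, cone = complex_of_real ` {0..}, order_unit = 1\<rparr>"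

lemma aou_space_complex: "aou_space complex_aou"
proof -
  let ?C = complex_aou
  have [simp]: "carrier ?C = UNIV" "add ?C x y = x + y" "zero ?C = 0" "smult ?C c x = c * x"
    "star ?C x = cnj x" "order_unit ?C = 1" for x y c
    by (simp_all add: complex_aou_def ring_of_type_algebra_def ring.defs)
  have cone: "z \<in> cone ?C \<longleftrightarrow> Im z = 0 \<and> 0 \<le> Re z" for z
    by (auto simp: complex_aou_def ring.defs ring_of_type_algebra_def image_iff complex_eq_iff)
  have herm: "z \<in> hermitian ?C \<longleftrightarrow> Im z = 0" for z
    by (auto simp: hermitian_def complex_eq_iff)
  have "abelian_group ?C"
  proof (rule abelian_groupI)
    show "\<exists>y\<in>carrier ?C. y \<oplus>\<^bsub>?C\<^esub> x = \<zero>\<^bsub>?C\<^esub>" for x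
      by (auto intro: exI[of _ "- x"])
  qed auto
  then have mod: "module (ring_of_type_algebra :: complex ring) ?C"
    by (intro moduleI cring_from_type_algebra) (auto simp: ring_of_type_algebra_def algebra_simps)
  interpret C: module "ring_of_type_algebra :: complex ring" ?C by (rule mod)
  have neg [simp]: "\<ominus>\<^bsub>?C\<^esub> x = - x" for x
    by (rule C.minus_equality) auto
  have "ordered_star_vector_space ?C"
  proof (intro ordered_star_vector_space.intro mod ordered_star_vector_space_axioms.intro)
    show "cone ?C \<inter> (\<lambda>x. \<ominus>\<^bsub>?C\<^esub> x) ` cone ?C = {\<zero>\<^bsub>?C\<^esub>}"
      by (auto simp: cone complex_eq_iff image_iff intro!: bexI[of _ 0])
  qed (auto simp: cone herm)
  moreover have "aou_space_axioms ?C"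
  proof
    fix x assume "x \<in> hermitian ?C"
    then show "\<exists>r>0. complex_of_real r \<odot>\<^bsub>?C\<^esub> order_unit ?C \<ominus>\<^bsub>?C\<^esub> x \<in> cone ?C"
      by (intro exI[of _ "\<bar>Re x\<bar> + 1"]) (auto simp: herm cone a_minus_def)
  next
    have "(\<forall>r>0. 0 \<le> r + a) \<longleftrightarrow> 0 \<le> a" for a :: real
    proof
      assume "\<forall>r>0. 0 \<le> r + a"
      from this[rule_format, of "- a / 2"] show "0 \<le> a" by (cases "a < 0") auto
    qed auto
    then have "z \<in> cone ?C \<longleftrightarrow> z \<in> hermitian ?C \<and>
        (\<forall>r>0. complex_of_real r \<odot>\<^bsub>?C\<^esub> order_unit ?C \<oplus>\<^bsub>?C\<^esub> z \<in> cone ?C)" for z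
      by (cases "Im z = 0") (simp_all add: herm cone)
    then show "cone ?C = {x \<in> hermitian ?C.
        \<forall>r>0. complex_of_real r \<odot>\<^bsub>?C\<^esub> order_unit ?C \<oplus>\<^bsub>?C\<^esub> x \<in> cone ?C}"
      by blast
  qed (auto simp: cone)
  ultimately show ?thesis by (rule aou_space.intro)
qed

definition states :: "('v, 'm) aou_scheme \<Rightarrow> ('v \<Rightarrow> complex) set" where
  "states V = aou_hom V complex_aou"

lemma states_iff:
  "f \<in> states V \<longleftrightarrow> f \<in> extensional (carrier V) \<and>
     (\<forall>x\<in>carrier V. \<forall>y\<in>carrier V. f (x \<oplus>\<^bsub>V\<^esub> y) = f x + f y) \<and>
     (\<forall>c. \<forall>x\<in>carrier V. f (c \<odot>\<^bsub>V\<^esub> x) = c * f x) \<and>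
     (\<forall>x\<in>cone V. \<exists>r\<ge>0. f x = complex_of_real r) \<and>
     f (order_unit V) = 1"
  by (auto simp: states_def aou_hom_def complex_aou_def ring_of_type_algebra_def
      ring.defs PiE_def image_subset_iff image_iff Bex_def)

definition state_space :: "('v, 'm) aou_scheme \<Rightarrow> ('v \<Rightarrow> complex) topology" where
  "state_space V = subtopology (product_topology (\<lambda>_. euclidean) (carrier V)) (states V)"

definition dual_map :: "('v, 'm) aou_scheme \<Rightarrow> ('v \<Rightarrow> 'w) \<Rightarrow> ('w \<Rightarrow> complex) \<Rightarrow> ('v \<Rightarrow> complex)" where
  "dual_map V \<phi> f = compose (carrier V) f \<phi>"

text \<open>Indices start at 0 rather than 1.\<close>

definition inductive_system :: "(nat \<Rightarrow> 'v aou) \<Rightarrow> (nat \<Rightarrow> 'v \<Rightarrow> 'v) \<Rightarrow> bool" where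
  "inductive_system V \<phi> \<longleftrightarrow>
     (\<forall>k. aou_space (V k)) \<and> (\<forall>k. \<phi> k \<in> aou_hom (V k) (V (Suc k)))"

definition cocone ::
    "(nat \<Rightarrow> 'v aou) \<Rightarrow> (nat \<Rightarrow> 'v \<Rightarrow> 'v) \<Rightarrow> 'v aou \<Rightarrow> (nat \<Rightarrow> 'v \<Rightarrow> 'v) \<Rightarrow> bool" where
  "cocone V \<phi> W \<psi> \<longleftrightarrow> aou_space W \<and>
     (\<forall>k. \<psi> k \<in> aou_hom (V k) W) \<and>
     (\<forall>k. compose (carrier (V k)) (\<psi> (Suc k)) (\<phi> k) = \<psi> k)"

text \<open>The type \<open>'v\<close> is the universe of the category: its objects are the AOU spaces whose
  carrier is any subset of \<open>'v\<close>, with arbitrary operations, and the universal property ranges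
  over all of these. As \<open>'v\<close> is arbitrary, so is the universe. No type is too small for the
  universal property to have its usual content: once some \<open>V k\<close> is nonzero, \<open>'v\<close> has at least
  the cardinality of the continuum, so that the complex numbers have an isomorphic copy in it.\<close>

definition is_inductive_limit ::
    "(nat \<Rightarrow> 'v aou) \<Rightarrow> (nat \<Rightarrow> 'v \<Rightarrow> 'v) \<Rightarrow> 'v aou \<Rightarrow> (nat \<Rightarrow> 'v \<Rightarrow> 'v) \<Rightarrow> bool" where
  "is_inductive_limit V \<phi> L \<iota> \<longleftrightarrow> cocone V \<phi> L \<iota> \<and>
     (\<forall>W \<psi>. cocone V \<phi> W \<psi> \<longrightarrow>
        (\<exists>!u. u \<in> aou_hom L W \<and> (\<forall>k. compose (carrier (V k)) u (\<iota> k) = \<psi> k)))"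

definition inverse_limit :: "(nat \<Rightarrow> 'a topology) \<Rightarrow> (nat \<Rightarrow> 'a \<Rightarrow> 'a) \<Rightarrow> (nat \<Rightarrow> 'a) topology" where
  "inverse_limit T f = subtopology (product_topology T UNIV) {x. \<forall>k. f k (x (Suc k)) = x k}"

end

theory Submission
  imports Defs
begin

text \<open>A state on the limit restricts to a compatible sequence of states. States are the morphisms
  into \<open>\<complex>\<close>, so the universal property makes this restriction bijective; as \<open>\<complex>\<close> need not lie in the
  universe \<open>'v\<close>, one uses its copy \<open>\<complex> e\<close> instead, where \<open>e\<close> is the order unit of a space that has
  a state and so is nonzero. The restriction is continuous from a space that is compact by
  Tychonoff's theorem to a Hausdorff space, hence a homeomorphism.\<close>

section \<open>Closed sets cut out by families of conditions\<close>

lemma closedin_Collect_ball: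
  assumes "\<And>i. i \<in> I \<Longrightarrow> closedin T {x \<in> topspace T. P i x}"
  shows "closedin T {x \<in> topspace T. \<forall>i\<in>I. P i x}"
proof -
  \<comment> \<open>Inserting \<open>topspace T\<close> keeps the family nonempty even when
    \<open>I\<close> is empty.\<close>
  have "closedin T (\<Inter> (insert (topspace T) ((\<lambda>i. {x \<in> topspace T. P i x}) ` I)))"
    using assms by (intro closedin_Inter) auto
  also have "\<dots> = {x \<in> topspace T. \<forall>i\<in>I. P i x}"
    by auto
  finally show ?thesis .
qed

lemma closedin_Collect_conj:
  assumes "closedin T {x \<in> topspace T. P x}" "closedin T {x \<in> topspace T. Q x}"
  shows "closedin T {x \<in> topspace T. P x \<and> Q x}"
proof -
  have "{x \<in> topspace T. P x \<and> Q x} = {x \<in> topspace T. P x} \<inter> {x \<in> topspace T. Q x}"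
    by auto
  then show ?thesis
    using closedin_Int[OF assms] by simp
qed

section \<open>States of a single AOU space: boundedness and compactness\<close>

context aou_space
begin

lemma cone_carrier: "x \<in> cone V \<Longrightarrow> x \<in> carrier V"
  using cone_hermitian by (auto simp: hermitian_def)

lemma order_unit_carrier: "order_unit V \<in> carrier V"
  using cone_carrier order_unit_cone by blast

lemma smult_carrier: "x \<in> carrier V \<Longrightarrow> c \<odot>\<^bsub>V\<^esub> x \<in> carrier V"
  using smult_closed[of c x] by (simp add: ring_of_type_algebra_def)

lemma aou_hom_compose:
  assumes "f \<in> aou_hom V W" "g \<in> aou_hom W U"
  shows "compose (carrier V) g f \<in> aou_hom V U"
  using assms cone_carrier order_unit_carrier
  by (auto simp: aou_hom_def compose_def smult_carrier PiE_def Pi_iff image_subset_iff)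

lemma dual_map_states:
  assumes "f \<in> aou_hom V W" "s \<in> states W"
  shows "dual_map V f s \<in> states V"
  using aou_hom_compose[OF assms(1)] assms(2) by (simp add: states_def dual_map_def)

text \<open>The state itself is a left inverse, since \<open>f\<close> is linear and takes the value
  1 at the order unit. This embeds the complex numbers in the type of vectors.\<close>

lemma inj_smult_order_unit:
  assumes "f \<in> states V"
  shows "inj (\<lambda>c. c \<odot>\<^bsub>V\<^esub> order_unit V)"
proof (rule inj_on_inverseI)
  show "f (c \<odot>\<^bsub>V\<^esub> order_unit V) = c" for c
    using assms order_unit_carrier by (simp add: states_iff)
qed

text \<open>Positivity of \<open>r e - x\<close>, with \<open>e\<close> the order unit, forces
  \<open>f x \<le> r\<close> for all states at once because \<open>f e = 1\<close>. Applying this to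
  \<open>x\<close> and to its negative bounds the absolute value.\<close>

lemma state_hermitian_bounded:
  assumes x: "x \<in> hermitian V"
  shows "\<exists>C. \<forall>f\<in>states V. norm (f x) \<le> C"
proof -
  \<comment> \<open>The negative is written as a scalar multiple, so that homogeneity of states and
    \<open>star_smult\<close> apply to it directly.\<close>
  let ?m = "complex_of_real (-1) \<odot>\<^bsub>V\<^esub> x"
  have bound: "\<exists>r. \<forall>f\<in>states V. Im (f y) = 0 \<and> Re (f y) \<le> r" if y: "y \<in> hermitian V" for y
  proof -
    obtain r where r: "complex_of_real r \<odot>\<^bsub>V\<^esub> order_unit V \<ominus>\<^bsub>V\<^esub> y \<in> cone V" (is "?z \<in> _")
      using order_unit_dominates[OF y] by blast
    have yc: "y \<in> carrier V" using y by (simp add: hermitian_def)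
    have sum: "?z \<oplus>\<^bsub>V\<^esub> y = complex_of_real r \<odot>\<^bsub>V\<^esub> order_unit V"
      using yc smult_carrier[OF order_unit_carrier, of r]
      by (simp add: a_minus_def a_assoc l_neg)
    have "Im (f y) = 0 \<and> Re (f y) \<le> r" if f: "f \<in> states V" for f
    proof -
      \<comment> \<open>As \<open>f ?z\<close> is real and nonnegative, this equation gives both
        that \<open>f y\<close> is real and that it is at most \<open>r\<close>.\<close>
      have "f ?z + f y = r"
        using f sum yc cone_carrier[OF r] order_unit_carrier
        unfolding states_iff by (metis mult.right_neutral)
      moreover obtain s where "s \<ge> 0" "f ?z = complex_of_real s"
        using f r unfolding states_iff by blast
      ultimately show ?thesis by (auto simp: complex_eq_iff)
    qed
    then show ?thesis by blast
  qed
  have xc: "x \<in> carrier V" using x by (simp add: hermitian_def)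
  have m: "?m \<in> hermitian V"
    using x star_smult[OF xc, of "complex_of_real (-1)"] by (simp add: hermitian_def smult_carrier)
  obtain r where r: "\<And>f. f \<in> states V \<Longrightarrow> Im (f x) = 0 \<and> Re (f x) \<le> r"
    using bound[OF x] by blast
  obtain s where s: "\<And>f. f \<in> states V \<Longrightarrow> Re (f ?m) \<le> s"
    using bound[OF m] by blast
  have "norm (f x) \<le> max r s" if f: "f \<in> states V" for f
  proof -
    have "f ?m = - f x"
      using f xc unfolding states_iff by simp
    then show ?thesis
      using r[OF f] s[OF f] by (auto simp: cmod_eq_Re)
  qed
  then show ?thesis by blast
qed

text \<open>Up to the factor 2, \<open>x\<close> is a complex combination of the hermitian elements
  \<open>?a\<close> and \<open>?b\<close>, whose values under states are already bounded. The
  argument does not need states to commute with the involution.\<close>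

lemma state_bounded:
  assumes x: "x \<in> carrier V"
  shows "\<exists>C. \<forall>f\<in>states V. norm (f x) \<le> C"
proof -
  let ?a = "x \<oplus>\<^bsub>V\<^esub> star V x"
  let ?b = "\<i> \<odot>\<^bsub>V\<^esub> x \<oplus>\<^bsub>V\<^esub> (- \<i>) \<odot>\<^bsub>V\<^esub> star V x"
  have sx: "star V x \<in> carrier V" using x by (rule star_closed)
  have "?a \<in> hermitian V"
    using x sx by (simp add: hermitian_def star_add star_star a_comm)
  moreover have "?b \<in> hermitian V"
    using x sx by (simp add: hermitian_def star_add star_star star_smult smult_carrier a_comm)
  ultimately obtain C D where C: "\<And>f. f \<in> states V \<Longrightarrow> norm (f ?a) \<le> C"
    and D: "\<And>f. f \<in> states V \<Longrightarrow> norm (f ?b) \<le> D"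
    using state_hermitian_bounded by meson
  have "norm (f x) \<le> C + D" if f: "f \<in> states V" for f
  proof -
    have a: "f ?a = f x + f (star V x)"
      using f x sx unfolding states_iff by blast
    have b: "f ?b = \<i> * f x + (- \<i>) * f (star V x)"
      using f x sx smult_carrier unfolding states_iff by metis
    have "2 * f x = f ?a - \<i> * f ?b"
      by (simp add: a b algebra_simps)
    then have "2 * norm (f x) \<le> norm (f ?a) + norm (\<i> * f ?b)"
      by (metis norm_mult norm_numeral norm_triangle_ineq4)
    then have "2 * norm (f x) \<le> C + D"
      using C[OF f] D[OF f] by (simp add: norm_mult)
    then show ?thesis
      using norm_ge_zero[of "f x"] by linarith
  qed
  then show ?thesis by blast
qed

text \<open>Each condition in \<open>states_iff\<close> involves finitely many evaluations, and
  these are continuous coordinate projections. The states are thus an intersection of closed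
  preimages.\<close>

lemma closedin_states: "closedin (product_topology (\<lambda>_. euclidean) (carrier V)) (states V)"
proof -
  let ?P = "product_topology (\<lambda>_. euclidean :: complex topology) (carrier V)"
  have ev: "continuous_map ?P euclidean (\<lambda>f. f x)" if "x \<in> carrier V" for x
    using continuous_map_product_projection[OF that, of "\<lambda>_. euclidean"] by simp
  have eq: "closedin ?P {f \<in> topspace ?P. F f = G f}"
    if "continuous_map ?P euclidean F" "continuous_map ?P euclidean G" for F G :: "_ \<Rightarrow> complex"
    using closedin_continuous_map_preimage[OF continuous_map_diff[OF that], of "{0}"] by simp
  have add: "closedin ?P {f \<in> topspace ?P. f (x \<oplus>\<^bsub>V\<^esub> y) = f x + f y}"
    if "x \<in> carrier V" "y \<in> carrier V" for x y
    using that by (intro eq continuous_map_add ev a_closed)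
  have smult: "closedin ?P {f \<in> topspace ?P. f (c \<odot>\<^bsub>V\<^esub> x) = c * f x}"
    if "x \<in> carrier V" for c x
  proof -
    have "continuous_map ?P euclidean ((*) c \<circ> (\<lambda>f. f x))"
      by (rule continuous_map_compose[OF ev[OF that]]) (simp add: continuous_on_mult_left)
    then show ?thesis
      using that by (intro eq ev smult_carrier) (auto simp: o_def)
  qed
  have "complex_of_real ` {0..} = \<real>\<^sub>\<ge>\<^sub>0"
    by (auto simp: nonneg_Reals_def)
  then have pos: "closedin ?P {f \<in> topspace ?P. f x \<in> complex_of_real ` {0..}}"
    if "x \<in> cone V" for x
    using that by (intro closedin_continuous_map_preimage[where Y = euclidean] ev cone_carrier) auto
  have unit: "closedin ?P {f \<in> topspace ?P. f (order_unit V) = 1}"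
    by (intro eq ev order_unit_carrier) auto
  \<comment> \<open>The scalar ranges over \<open>UNIV\<close> explicitly, to match the bounded
    quantifier of \<open>closedin_Collect_ball\<close>.\<close>
  have "closedin ?P {f \<in> topspace ?P.
      (\<forall>x\<in>carrier V. \<forall>y\<in>carrier V. f (x \<oplus>\<^bsub>V\<^esub> y) = f x + f y) \<and>
      (\<forall>c\<in>UNIV. \<forall>x\<in>carrier V. f (c \<odot>\<^bsub>V\<^esub> x) = c * f x) \<and>
      (\<forall>x\<in>cone V. f x \<in> complex_of_real ` {0..}) \<and> f (order_unit V) = 1}"
    by (intro closedin_Collect_conj closedin_Collect_ball add smult pos unit)
  also have "\<dots> = states V"
    by (auto simp: states_iff PiE_def image_iff Bex_def)
  finally show ?thesis .
qed

text \<open>The Banach-Alaoglu argument: the states form a closed subset of a product of closed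
  discs, whose radii \<open>C x\<close> depend on the vector \<open>x\<close> alone.\<close>

lemma compact_space_state_space: "compact_space (state_space V)"
proof -
  let ?P = "product_topology (\<lambda>_. euclidean :: complex topology) (carrier V)"
  obtain C where C: "\<And>x f. x \<in> carrier V \<Longrightarrow> f \<in> states V \<Longrightarrow> norm (f x) \<le> C x"
    using state_bounded by metis
  have "compactin ?P (PiE (carrier V) (\<lambda>x. cball 0 (C x)))"
    by (simp add: compactin_PiE)
  moreover have "states V \<subseteq> PiE (carrier V) (\<lambda>x. cball 0 (C x))"
    using C by (auto simp: states_iff PiE_def)
  ultimately have "compactin ?P (states V)"
    using closed_compactin closedin_states by blast
  then show ?thesis
    by (simp add: state_space_def compact_space_subtopology)
qed

end

section \<open>Topology of state spaces and inverse limits\<close>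

lemma topspace_state_space [simp]: "topspace (state_space V) = states V"
  by (auto simp: state_space_def states_iff PiE_def)

lemma Hausdorff_space_state_space: "Hausdorff_space (state_space V)"
  unfolding state_space_def
  by (intro Hausdorff_space_subtopology) (simp add: Hausdorff_space_product_topology)

text \<open>Weak* continuity is tested coordinate by coordinate, and the coordinate of the image at
  \<open>x\<close> is evaluation of the given state at \<open>f x\<close>.\<close>

lemma continuous_map_dual_map:
  assumes "aou_space V" "f \<in> aou_hom V W"
  shows "continuous_map (state_space W) (state_space V) (dual_map V f)"
proof -
  have "continuous_map (state_space W) euclidean (\<lambda>s. s (f x))" if "x \<in> carrier V" for x
  proof -
    have "f x \<in> carrier W"
      using assms that by (auto simp: aou_hom_def)
    then show ?thesis
      unfolding state_space_def
      using continuous_map_product_projection[of "f x" "carrier W" "\<lambda>_. euclidean"]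
      by (intro continuous_map_from_subtopology) simp
  qed
  then show ?thesis
    unfolding state_space_def[of V] using aou_space.dual_map_states[OF assms]
    by (auto simp: continuous_map_in_subtopology continuous_map_componentwise dual_map_def
        compose_def image_subset_iff)
qed

lemma topspace_inverse_limit:
  "topspace (inverse_limit T f) = {x. \<forall>k. x k \<in> topspace (T k) \<and> f k (x (Suc k)) = x k}"
  by (auto simp: inverse_limit_def)

lemma Hausdorff_space_inverse_limit:
  "(\<And>k. Hausdorff_space (T k)) \<Longrightarrow> Hausdorff_space (inverse_limit T f)"
  unfolding inverse_limit_def
  by (intro Hausdorff_space_subtopology) (simp add: Hausdorff_space_product_topology)

section \<open>A copy of the complex numbers inside the universe\<close>

definition complex_aou_copy :: "(complex \<Rightarrow> 'v) \<Rightarrow> 'v aou" where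
  "complex_aou_copy g =
     \<lparr>carrier = range g, mult = undefined, one = undefined, zero = g 0,
      add = (\<lambda>x y. g (inv_into UNIV g x + inv_into UNIV g y)), smult = (\<lambda>c x. g (c * inv_into UNIV g x)),
      star = (\<lambda>x. g (cnj (inv_into UNIV g x))), cone = g ` complex_of_real ` {0..}, order_unit = g 1\<rparr>"

text \<open>Transport of structure: injectivity makes \<open>inv_into UNIV g\<close> a left inverse
  of \<open>g\<close>, so each axiom on elements \<open>g a\<close> turns into its counterpart for
  complex numbers.\<close>

lemma aou_space_complex_aou_copy:
  assumes g: "inj g"
  shows "aou_space (complex_aou_copy g)"
proof -
  let ?C = "complex_aou_copy g"
  have [simp]: "carrier ?C = range g" "add ?C (g a) (g b) = g (a + b)" "zero ?C = g 0"
    "smult ?C c (g a) = g (c * a)" "star ?C (g a) = g (cnj a)" "order_unit ?C = g 1"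
    "g a = g b \<longleftrightarrow> a = b" for a b c
    using g by (simp_all add: complex_aou_copy_def inj_eq)
  have cone_iff: "x \<in> cone ?C \<longleftrightarrow> (\<exists>z. x = g z \<and> Im z = 0 \<and> 0 \<le> Re z)" for x
    by (auto simp: complex_aou_copy_def image_iff complex_eq_iff Bex_def)
  have herm_iff: "x \<in> hermitian ?C \<longleftrightarrow> (\<exists>z. x = g z \<and> Im z = 0)" for x
    by (auto simp: hermitian_def complex_eq_iff)
  have "abelian_group ?C"
  proof (rule abelian_groupI)
    show "\<exists>y\<in>carrier ?C. y \<oplus>\<^bsub>?C\<^esub> x = \<zero>\<^bsub>?C\<^esub>" if "x \<in> carrier ?C" for x
    proof -
      from that obtain z where "x = g z" by auto
      then show ?thesis by (intro bexI[of _ "g (- z)"]) auto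
    qed
  qed (auto simp: algebra_simps)
  then have mod: "module (ring_of_type_algebra :: complex ring) ?C"
    by (intro moduleI cring_from_type_algebra) (auto simp: ring_of_type_algebra_def algebra_simps)
  interpret C: module "ring_of_type_algebra :: complex ring" ?C by (rule mod)
  have neg [simp]: "\<ominus>\<^bsub>?C\<^esub> (g a) = g (- a)" for a
    by (rule C.minus_equality) auto
  have "ordered_star_vector_space ?C"
  proof (intro ordered_star_vector_space.intro mod ordered_star_vector_space_axioms.intro)
    show "cone ?C \<inter> (\<lambda>x. \<ominus>\<^bsub>?C\<^esub> x) ` cone ?C = {\<zero>\<^bsub>?C\<^esub>}"
    proof (intro equalityI subsetI)
      fix x assume "x \<in> cone ?C \<inter> (\<lambda>x. \<ominus>\<^bsub>?C\<^esub> x) ` cone ?C"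
      then obtain z w where "x = g z" "Im z = 0" "0 \<le> Re z" "x = \<ominus>\<^bsub>?C\<^esub> (g w)" "0 \<le> Re w"
        by (auto simp: cone_iff)
      then show "x \<in> {\<zero>\<^bsub>?C\<^esub>}" by (auto simp: complex_eq_iff)
    next
      fix x assume "x \<in> {\<zero>\<^bsub>?C\<^esub>}"
      moreover have "g 0 \<in> cone ?C" by (auto simp: cone_iff)
      moreover have "g 0 = \<ominus>\<^bsub>?C\<^esub> (g 0)" by simp
      ultimately show "x \<in> cone ?C \<inter> (\<lambda>x. \<ominus>\<^bsub>?C\<^esub> x) ` cone ?C"
        by (auto intro: rev_image_eqI)
    qed
  next
    fix x y assume "x \<in> cone ?C" "y \<in> cone ?C"
    then show "x \<oplus>\<^bsub>?C\<^esub> y \<in> cone ?C" by (fastforce simp: cone_iff)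
  next
    fix x and r :: real assume "0 \<le> r" "x \<in> cone ?C"
    then show "complex_of_real r \<odot>\<^bsub>?C\<^esub> x \<in> cone ?C" by (fastforce simp: cone_iff)
  qed (auto simp: cone_iff herm_iff)
  moreover have "aou_space_axioms ?C"
  proof
    fix x assume "x \<in> hermitian ?C"
    then obtain z where "x = g z" "Im z = 0" by (auto simp: herm_iff)
    then show "\<exists>r>0. complex_of_real r \<odot>\<^bsub>?C\<^esub> order_unit ?C \<ominus>\<^bsub>?C\<^esub> x \<in> cone ?C"
      by (intro exI[of _ "\<bar>Re z\<bar> + 1"]) (auto simp: cone_iff a_minus_def)
  next
    have nonneg: "(\<forall>r>0. 0 \<le> r + a) \<longleftrightarrow> 0 \<le> a" for a :: real
      using field_le_epsilon[of 0 a] by (auto simp: add.commute)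
    have "x \<in> cone ?C \<longleftrightarrow> x \<in> hermitian ?C \<and>
        (\<forall>r>0. complex_of_real r \<odot>\<^bsub>?C\<^esub> order_unit ?C \<oplus>\<^bsub>?C\<^esub> x \<in> cone ?C)" for x
    proof (cases "x \<in> range g")
      case True
      then obtain z where "x = g z" by auto
      then show ?thesis by (cases "Im z = 0") (simp_all add: herm_iff cone_iff nonneg)
    next
      case False
      then show ?thesis by (auto simp: herm_iff cone_iff)
    qed
    then show "cone ?C = {x \<in> hermitian ?C.
        \<forall>r>0. complex_of_real r \<odot>\<^bsub>?C\<^esub> order_unit ?C \<oplus>\<^bsub>?C\<^esub> x \<in> cone ?C}"
      by blast
  qed (auto simp: cone_iff)
  ultimately show ?thesis by (rule aou_space.intro)
qed

lemma complex_aou_simps: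
  "carrier complex_aou = UNIV" "add complex_aou x y = x + y" "smult complex_aou c x = c * x"
  "order_unit complex_aou = 1" "cone complex_aou = complex_of_real ` {0..}"
  by (simp_all add: complex_aou_def ring_of_type_algebra_def ring.defs)

text \<open>The two maps are mutually inverse, so states amount to morphisms into the copy. The
  \<open>restrict\<close> supplies the extensionality that \<open>aou_hom\<close> demands.\<close>

lemma complex_aou_copy_hom:
  assumes "inj g"
  shows "g \<in> aou_hom complex_aou (complex_aou_copy g)"
    and "restrict (inv_into UNIV g) (range g) \<in> aou_hom (complex_aou_copy g) complex_aou"
  using assms by (auto simp: aou_hom_def complex_aou_simps complex_aou_copy_def inj_eq)

section \<open>Contravariance of duals and the homeomorphism\<close>

lemma dual_map_compose:
  assumes "f \<in> aou_hom V W"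
  shows "dual_map V f (dual_map W h s) = dual_map V (compose (carrier V) h f) s"
  unfolding dual_map_def
  by (rule compose_assoc[symmetric]) (use assms in \<open>auto simp: aou_hom_def\<close>)

theorem proposition3p16:
  fixes V :: "nat \<Rightarrow> 'v aou" and \<phi> :: "nat \<Rightarrow> 'v \<Rightarrow> 'v"
    and L :: "'v aou" and \<iota> :: "nat \<Rightarrow> 'v \<Rightarrow> 'v"
  assumes "inductive_system V \<phi>"
    and "is_inductive_limit V \<phi> L \<iota>"
  shows "state_space L homeomorphic_space
    inverse_limit (\<lambda>k. state_space (V k)) (\<lambda>k. dual_map (V k) (\<phi> k))"
proof -
  let ?I = "inverse_limit (\<lambda>k. state_space (V k)) (\<lambda>k. dual_map (V k) (\<phi> k))"
  let ?R = "\<lambda>s k. dual_map (V k) (\<iota> k) s"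
  have V: "aou_space (V k)" and \<phi>: "\<phi> k \<in> aou_hom (V k) (V (Suc k))" for k
    using assms(1) by (auto simp: inductive_system_def)
  have L: "aou_space L" and \<iota>: "\<iota> k \<in> aou_hom (V k) L"
    and \<iota>_\<phi>: "compose (carrier (V k)) (\<iota> (Suc k)) (\<phi> k) = \<iota> k" for k
    using assms(2) by (auto simp: is_inductive_limit_def cocone_def)
  have univ: "\<exists>!u. u \<in> aou_hom L W \<and> (\<forall>k. compose (carrier (V k)) u (\<iota> k) = \<psi> k)"
    if "cocone V \<phi> W \<psi>" for W \<psi>
    using assms(2) that by (simp add: is_inductive_limit_def)
  have \<iota>_carrier: "\<iota> k \<in> carrier (V k) \<rightarrow> carrier L" for k
    using \<iota>[of k] by (auto simp: aou_hom_def)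
  have \<phi>_carrier: "\<phi> k \<in> carrier (V k) \<rightarrow> carrier (V (Suc k))" for k
    using \<phi>[of k] by (auto simp: aou_hom_def)

  \<comment> \<open>A point of the inverse limit is a cocone with vertex the complex numbers;
    following it by \<open>g\<close> moves the vertex into the universe, where the universal
    property applies.\<close>
  have copy_cocone: "cocone V \<phi> (complex_aou_copy g) (\<lambda>k. compose (carrier (V k)) g (x k))"
    if g: "inj g" and x: "x \<in> topspace ?I" for g x
    unfolding cocone_def
  proof (intro conjI allI)
    fix k
    show "compose (carrier (V k)) g (x k) \<in> aou_hom (V k) (complex_aou_copy g)"
      using aou_space.aou_hom_compose[OF V _ complex_aou_copy_hom(1)[OF g]] x
      by (simp add: topspace_inverse_limit states_def)
    show "compose (carrier (V k)) (compose (carrier (V (Suc k))) g (x (Suc k))) (\<phi> k) =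
        compose (carrier (V k)) g (x k)"
      using compose_assoc[OF \<phi>_carrier] x
      by (metis (mono_tags, lifting) dual_map_def mem_Collect_eq topspace_inverse_limit)
  qed (rule aou_space_complex_aou_copy[OF g])

  have R_topspace: "?R s \<in> topspace ?I" if s: "s \<in> states L" for s
    using s by (simp add: topspace_inverse_limit aou_space.dual_map_states[OF V \<iota>]
        dual_map_compose[OF \<phi>] \<iota>_\<phi>)

  have "inj_on ?R (states L)"
  proof (rule inj_onI)
    fix s t assume s: "s \<in> states L" and t: "t \<in> states L" and eq: "?R s = ?R t"
    let ?g = "\<lambda>c. c \<odot>\<^bsub>L\<^esub> order_unit L"
    have g: "inj ?g" by (rule aou_space.inj_smult_order_unit[OF L s])
    \<comment> \<open>Followed by \<open>?g\<close>, every state with the same restrictions as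
      \<open>s\<close> is a mediating morphism for one and the same cocone.\<close>
    have hom: "compose (carrier L) ?g r \<in> aou_hom L (complex_aou_copy ?g) \<and>
        (\<forall>k. compose (carrier (V k)) (compose (carrier L) ?g r) (\<iota> k) =
          compose (carrier (V k)) ?g (?R s k))"
      if "r \<in> states L" "?R r = ?R s" for r
    proof (intro conjI allI)
      show "compose (carrier L) ?g r \<in> aou_hom L (complex_aou_copy ?g)"
        using aou_space.aou_hom_compose[OF L _ complex_aou_copy_hom(1)[OF g]] that(1)
        by (simp add: states_def)
      show "compose (carrier (V k)) (compose (carrier L) ?g r) (\<iota> k) =
          compose (carrier (V k)) ?g (?R s k)" for k
        using fun_cong[OF that(2), of k]
        by (simp add: dual_map_def compose_assoc[OF \<iota>_carrier, symmetric])
    qed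
    \<comment> \<open>This is the uniqueness half of the universal property; injectivity of
      \<open>?g\<close> then cancels it.\<close>
    have "compose (carrier L) ?g s = compose (carrier L) ?g t"
      using univ[OF copy_cocone[OF g R_topspace[OF s]]] hom[OF s] hom[OF t] eq by metis
    then have "s x = t x" if "x \<in> carrier L" for x
      using that g by (metis (mono_tags, lifting) compose_eq injD)
    moreover have "s \<in> extensional (carrier L)" "t \<in> extensional (carrier L)"
      using s t by (simp_all add: states_iff)
    ultimately show "s = t"
      using extensionalityI by blast
  qed
  moreover have "?R ` states L = topspace ?I"
  proof
    show "topspace ?I \<subseteq> ?R ` states L"
    proof
      fix x assume x: "x \<in> topspace ?I"
      \<comment> \<open>No state on \<open>L\<close> is available yet, so the order unit comes from
        \<open>V 0\<close>, which has the state \<open>x 0\<close>.\<close>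
      let ?g = "\<lambda>c. c \<odot>\<^bsub>V 0\<^esub> order_unit (V 0)"
      have xk: "x k \<in> states (V k)" for k
        using x by (simp add: topspace_inverse_limit)
      have g: "inj ?g" by (rule aou_space.inj_smult_order_unit[OF V xk])
      let ?h = "restrict (inv_into UNIV ?g) (range ?g)"
      obtain u where u: "u \<in> aou_hom L (complex_aou_copy ?g)"
        "\<And>k. compose (carrier (V k)) u (\<iota> k) = compose (carrier (V k)) ?g (x k)"
        using univ[OF copy_cocone[OF g x]] by auto
      \<comment> \<open>The existence half of the universal property gives \<open>u\<close> with
        values in the copy; \<open>?h\<close> carries them back to the complex numbers.\<close>
      let ?s = "compose (carrier L) ?h u"
      have s: "?s \<in> states L"
        unfolding states_def
        by (rule aou_space.aou_hom_compose[OF L u(1) complex_aou_copy_hom(2)[OF g]])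
      have "?R ?s k = x k" for k
      \<comment> \<open>Both sides are extensional, so it suffices to compare them on
        \<open>carrier (V k)\<close>.\<close>
      proof (rule extensionalityI)
        show "?R ?s k \<in> extensional (carrier (V k))" by (simp add: dual_map_def)
        show "x k \<in> extensional (carrier (V k))" using xk[of k] by (simp add: states_iff)
      next
        fix v assume v: "v \<in> carrier (V k)"
        have "u (\<iota> k v) = ?g (x k v)"
          using fun_cong[OF u(2), of k v] v by (simp add: compose_eq)
        then show "?R ?s k v = x k v"
          using v \<iota>_carrier[of k] inv_f_f[OF g] by (simp add: dual_map_def compose_eq Pi_iff)
      qed
      then show "x \<in> ?R ` states L"
        using s by (intro image_eqI[of _ _ ?s]) auto
    qed
  qed (use R_topspace in blast)
  moreover have "continuous_map (state_space L) ?I ?R"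
    unfolding inverse_limit_def
    using R_topspace continuous_map_dual_map[OF V \<iota>]
    by (auto simp: continuous_map_in_subtopology continuous_map_componentwise_UNIV
        topspace_inverse_limit)
  ultimately have "homeomorphic_map (state_space L) ?I ?R"
    by (intro continuous_imp_homeomorphic_map Hausdorff_space_inverse_limit
        Hausdorff_space_state_space aou_space.compact_space_state_space[OF L]) auto
  then show ?thesis
    by (rule homeomorphic_map_imp_homeomorphic_space)
qed

end
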